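(* Let $(A,\theta)$ be an independence alphabet, $B\subset A$ and $Z=A\setminus B$. The following assertions are equivalent. (i) $B$ is a transitively factorizing subalphabet (TFSA) of $(A,\theta)$. (ii) For all $z_1\neq z_2$ in $Z$ and all $w_1,w_2,w_1',w_2'\in M(B,\theta_B)$ such that $IA(z_1w_1)=IA(z_1w_1')=\{z_1\}$ and $IA(z_2w_2)=IA(z_2w_2')=\{z_2\}$, one has $$z_1w_1z_2w_2=z_2w_2'z_1w_1'\ \Longrightarrow\ w_1=w_1' \text{ and } w_2=w_2'.$$ (iii) For each $(z,z')\in Z^2\cap\theta$, the dependence graph contains no path $z-b_1-\dots-b_n-z'$ with $n\ge 1$ and $b_1,\dots,b_n\in B$ (i.e. there are no $b_1,\dots,b_n\in B$ such that consecutive terms of the sequence $z,b_1,\dots,b_n,z'$ are adjacent in the dependence graph).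
   Context: An independence alphabet $(A,\theta)$ is a set $A$ with a symmetric, antireflexive relation $\theta\subset A\times A$. $M(A,\theta)=\langle A\mid ab=ba,\ (a,b)\in\theta\rangle$ is the free partially commutative monoid; its elements are called traces. $\mathrm{Alph}(t)$ is the set of letters occurring in $t$, and $IA(t)=\{a\in A\mid t=aw \text{ for some } w\in M(A,\theta)\}$. The dependence graph has vertex set $A$ and edge set $(A\times A)\setminus(\Delta\cup\theta)$ with $\Delta=\{(a,a)\mid a\in A\}$. For $X\subset M(A,\theta)$, $\langle X\rangle$ is the submonoid generated by $X$ and $\theta_X=\{(x_1,x_2)\in X^2\mid \mathrm{Alph}(x_1)\times\mathrm{Alph}(x_2)\subset\theta\}$. For $B\subset A$, $M(B,\theta_B)$ is identified with the submonoid of $M(A,\theta)$ generated by $B$. $X$ is a partially commutative code if every element of $\langle X\rangle$ has a unique decomposition as a product of elements of $X$ up to the commutations in $\theta_X$, i.e. the natural morphism $M(X,\theta_X)\to\langle X\rangle$ is an isomorphism. For $B\subset A$ and $Z=A\setminus B$, $\beta_Z(B)=\{zw\mid z\in Z,\ w\in M(B,\theta_B),\ IA(zw)=\{z\}\}$. $B$ is a transitively factorizing subalphabet (TFSA) if $\beta_Z(B)$ is a partially commutative code. *)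

theory Defs
  imports "HOL-Algebra.Group"
begin

definition independence_alphabet :: "'a set \<Rightarrow> ('a \<times> 'a) set \<Rightarrow> bool" where
  "independence_alphabet A \<theta> \<longleftrightarrow> \<theta> \<subseteq> A \<times> A \<and> sym \<theta> \<and> irrefl \<theta>"

text \<open>The congruence on the free monoid over \<open>A\<close> generated by \<open>ab = ba\<close> for
  \<open>(a, b) \<in> \<theta>\<close>.\<close>

inductive_set trace_cong :: "'a set \<Rightarrow> ('a \<times> 'a) set \<Rightarrow> ('a list \<times> 'a list) set"
  for A :: "'a set" and \<theta> :: "('a \<times> 'a) set" where
  refl: "u \<in> lists A \<Longrightarrow> (u, u) \<in> trace_cong A \<theta>"
| comm: "\<lbrakk>a \<in> A; b \<in> A; (a, b) \<in> \<theta>; u \<in> lists A; v \<in> lists A\<rbrakk>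
    \<Longrightarrow> (u @ [a, b] @ v, u @ [b, a] @ v) \<in> trace_cong A \<theta>"
| sym: "(u, v) \<in> trace_cong A \<theta> \<Longrightarrow> (v, u) \<in> trace_cong A \<theta>"
| trans: "\<lbrakk>(u, v) \<in> trace_cong A \<theta>; (v, w) \<in> trace_cong A \<theta>\<rbrakk> \<Longrightarrow> (u, w) \<in> trace_cong A \<theta>"

definition trace_of :: "'a set \<Rightarrow> ('a \<times> 'a) set \<Rightarrow> 'a list \<Rightarrow> 'a list set" where
  "trace_of A \<theta> u = trace_cong A \<theta> `` {u}"

text \<open>The free partially commutative monoid \<open>M(A,\<theta>)\<close>; a trace is an equivalence class of words.
  The product does not depend on representatives, see \<open>trace_of_mult\<close> below.\<close>

definition trace_monoid :: "'a set \<Rightarrow> ('a \<times> 'a) set \<Rightarrow> 'a list set monoid" where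
  "trace_monoid A \<theta> =
    \<lparr>carrier = lists A // trace_cong A \<theta>,
     mult = (\<lambda>s t. \<Union>u\<in>s. \<Union>v\<in>t. trace_of A \<theta> (u @ v)),
     one = trace_of A \<theta> []\<rparr>"

abbreviation letter :: "'a set \<Rightarrow> ('a \<times> 'a) set \<Rightarrow> 'a \<Rightarrow> 'a list set" where
  "letter A \<theta> a \<equiv> trace_of A \<theta> [a]"

definition Alph :: "'a list set \<Rightarrow> 'a set" where
  "Alph t = (\<Union>u\<in>t. set u)"

definition IA :: "'a set \<Rightarrow> ('a \<times> 'a) set \<Rightarrow> 'a list set \<Rightarrow> 'a set" where
  "IA A \<theta> t =
    {a \<in> A. \<exists>w \<in> carrier (trace_monoid A \<theta>). t = letter A \<theta> a \<otimes>\<^bsub>trace_monoid A \<theta>\<^esub> w}"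

inductive_set submonoid_generated :: "('m, 'r) monoid_scheme \<Rightarrow> 'm set \<Rightarrow> 'm set"
  for G (structure) and X :: "'m set" where
  one: "\<one> \<in> submonoid_generated G X"
| incl: "x \<in> X \<Longrightarrow> x \<in> submonoid_generated G X"
| mult: "\<lbrakk>x \<in> submonoid_generated G X; y \<in> submonoid_generated G X\<rbrakk>
    \<Longrightarrow> x \<otimes> y \<in> submonoid_generated G X"

text \<open>\<open>M(B,\<theta>\<^sub>B)\<close>, viewed inside \<open>M(A,\<theta>)\<close>.\<close>

definition subalphabet_traces :: "'a set \<Rightarrow> ('a \<times> 'a) set \<Rightarrow> 'a set \<Rightarrow> 'a list set set" where
  "subalphabet_traces A \<theta> B = submonoid_generated (trace_monoid A \<theta>) (letter A \<theta> ` B)"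

definition induced_independence ::
  "('a \<times> 'a) set \<Rightarrow> 'a list set set \<Rightarrow> ('a list set \<times> 'a list set) set" where
  "induced_independence \<theta> X = {(x\<^sub>1, x\<^sub>2). x\<^sub>1 \<in> X \<and> x\<^sub>2 \<in> X \<and> Alph x\<^sub>1 \<times> Alph x\<^sub>2 \<subseteq> \<theta>}"

definition word_product :: "('m, 'r) monoid_scheme \<Rightarrow> 'm list \<Rightarrow> 'm" where
  "word_product G xs = foldr (\<otimes>\<^bsub>G\<^esub>) xs \<one>\<^bsub>G\<^esub>"

text \<open>The morphism \<open>M(X,\<theta>\<^sub>X) \<rightarrow> \<langle>X\<rangle>\<close> sends the class of a word \<open>x\<^sub>1, \<dots>, x\<^sub>n\<close> over \<open>X\<close> to the
  product \<open>x\<^sub>1 \<cdots> x\<^sub>n\<close> in \<open>M(A,\<theta>)\<close>; the image of a class is a singleton, see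
  \<open>natural_morphism_trace_of\<close> below.\<close>

definition natural_morphism ::
  "'a set \<Rightarrow> ('a \<times> 'a) set \<Rightarrow> 'a list set list set \<Rightarrow> 'a list set" where
  "natural_morphism A \<theta> T = the_elem (word_product (trace_monoid A \<theta>) ` T)"

definition partially_commutative_code ::
  "'a set \<Rightarrow> ('a \<times> 'a) set \<Rightarrow> 'a list set set \<Rightarrow> bool" where
  "partially_commutative_code A \<theta> X \<longleftrightarrow>
    X \<subseteq> carrier (trace_monoid A \<theta>) \<and>
    natural_morphism A \<theta> \<in>
      iso (trace_monoid X (induced_independence \<theta> X))
          ((trace_monoid A \<theta>)\<lparr>carrier := submonoid_generated (trace_monoid A \<theta>) X\<rparr>)"

text \<open>\<open>\<beta>\<^sub>Z(B)\<close> with \<open>Z = A - B\<close>.\<close>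

definition beta :: "'a set \<Rightarrow> ('a \<times> 'a) set \<Rightarrow> 'a set \<Rightarrow> 'a list set set" where
  "beta A \<theta> B =
    {letter A \<theta> z \<otimes>\<^bsub>trace_monoid A \<theta>\<^esub> w | z w.
      z \<in> A - B \<and> w \<in> subalphabet_traces A \<theta> B \<and>
      IA A \<theta> (letter A \<theta> z \<otimes>\<^bsub>trace_monoid A \<theta>\<^esub> w) = {z}}"

definition TFSA :: "'a set \<Rightarrow> ('a \<times> 'a) set \<Rightarrow> 'a set \<Rightarrow> bool" where
  "TFSA A \<theta> B \<longleftrightarrow> partially_commutative_code A \<theta> (beta A \<theta> B)"

definition dependence_edges :: "'a set \<Rightarrow> ('a \<times> 'a) set \<Rightarrow> ('a \<times> 'a) set" where
  "dependence_edges A \<theta> = (A \<times> A) - (Id_on A \<union> \<theta>)"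

lemma trace_cong_lists:
  "(u, v) \<in> trace_cong A \<theta> \<Longrightarrow> u \<in> lists A \<and> v \<in> lists A"
  by (induction rule: trace_cong.induct) auto

lemma equiv_trace_cong: "equiv (lists A) (trace_cong A \<theta>)"
proof (rule equivI)
  show "trace_cong A \<theta> \<subseteq> lists A \<times> lists A"
    by (meson SigmaI subrelI trace_cong_lists)
  show "refl_on (lists A) (trace_cong A \<theta>)"
    by (rule refl_onI) (rule trace_cong.refl)
  show "Relation.sym (trace_cong A \<theta>)"
    by (rule symI) (rule trace_cong.sym)
  show "Relation.trans (trace_cong A \<theta>)"
    by (rule transI) (rule trace_cong.trans)
qed

lemma trace_cong_append_left:
  "(u, v) \<in> trace_cong A \<theta> \<Longrightarrow> w \<in> lists A \<Longrightarrow> (w @ u, w @ v) \<in> trace_cong A \<theta>"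
proof (induction rule: trace_cong.induct)
  case (refl u)
  then show ?case by (simp add: trace_cong.refl)
next
  case (comm a b u v)
  then show ?case using trace_cong.comm[of a A b \<theta> "w @ u" v] by simp
next
  case (sym u v)
  then show ?case using trace_cong.sym by blast
next
  case (trans u v w')
  then show ?case using trace_cong.trans by blast
qed

lemma trace_cong_append_right:
  "(u, v) \<in> trace_cong A \<theta> \<Longrightarrow> w \<in> lists A \<Longrightarrow> (u @ w, v @ w) \<in> trace_cong A \<theta>"
proof (induction rule: trace_cong.induct)
  case (refl u)
  then show ?case by (simp add: trace_cong.refl)
next
  case (comm a b u v)
  then show ?case using trace_cong.comm[of a A b \<theta> u "v @ w"] by simp
next
  case (sym u v)
  then show ?case using trace_cong.sym by blast
next
  case (trans u v w')
  then show ?case using trace_cong.trans by blast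
qed

lemma trace_cong_append:
  assumes "(u, u') \<in> trace_cong A \<theta>" "(v, v') \<in> trace_cong A \<theta>"
  shows "(u @ v, u' @ v') \<in> trace_cong A \<theta>"
proof (rule trace_cong.trans)
  show "(u @ v, u' @ v) \<in> trace_cong A \<theta>"
    using assms trace_cong_lists by (intro trace_cong_append_right) blast+
  show "(u' @ v, u' @ v') \<in> trace_cong A \<theta>"
    using assms trace_cong_lists by (intro trace_cong_append_left) blast+
qed

lemma trace_of_eqI: "(u, v) \<in> trace_cong A \<theta> \<Longrightarrow> trace_of A \<theta> u = trace_of A \<theta> v"
  unfolding trace_of_def by (rule equiv_class_eq[OF equiv_trace_cong])

lemma trace_of_eq_iff:
  "u \<in> lists A \<Longrightarrow> v \<in> lists A \<Longrightarrow>
    trace_of A \<theta> u = trace_of A \<theta> v \<longleftrightarrow> (u, v) \<in> trace_cong A \<theta>"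
  unfolding trace_of_def by (rule eq_equiv_class_iff[OF equiv_trace_cong])

lemma mem_trace_of_iff: "v \<in> trace_of A \<theta> u \<longleftrightarrow> (u, v) \<in> trace_cong A \<theta>"
  by (simp add: trace_of_def)

lemma carrier_trace_monoid: "carrier (trace_monoid A \<theta>) = trace_of A \<theta> ` lists A"
  unfolding trace_monoid_def quotient_def trace_of_def by force

lemma one_trace_monoid: "\<one>\<^bsub>trace_monoid A \<theta>\<^esub> = trace_of A \<theta> []"
  by (simp add: trace_monoid_def)

lemma trace_of_mult:
  assumes "u \<in> lists A" "v \<in> lists A"
  shows "trace_of A \<theta> u \<otimes>\<^bsub>trace_monoid A \<theta>\<^esub> trace_of A \<theta> v = trace_of A \<theta> (u @ v)"
proof -
  have eq: "trace_of A \<theta> (u' @ v') = trace_of A \<theta> (u @ v)"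
    if "u' \<in> trace_of A \<theta> u" "v' \<in> trace_of A \<theta> v" for u' v'
    using that unfolding mem_trace_of_iff
    by (intro trace_of_eqI[symmetric] trace_cong_append)
  have mem: "u \<in> trace_of A \<theta> u" "v \<in> trace_of A \<theta> v"
    using assms unfolding mem_trace_of_iff by (simp_all only: trace_cong.refl)
  have "(\<Union>u'\<in>trace_of A \<theta> u. \<Union>v'\<in>trace_of A \<theta> v. trace_of A \<theta> (u' @ v')) =
      (\<Union>u'\<in>trace_of A \<theta> u. \<Union>v'\<in>trace_of A \<theta> v. trace_of A \<theta> (u @ v))"
    by (rule SUP_cong[OF HOL.refl SUP_cong[OF HOL.refl eq]])
  also have "\<dots> = trace_of A \<theta> (u @ v)"
    using mem by blast
  finally show ?thesis by (simp only: trace_monoid_def monoid.simps)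
qed

lemma monoid_trace_monoid: "monoid (trace_monoid A \<theta>)"
proof (rule monoidI)
  fix x y
  assume "x \<in> carrier (trace_monoid A \<theta>)" "y \<in> carrier (trace_monoid A \<theta>)"
  then obtain u v where "x = trace_of A \<theta> u" "u \<in> lists A" "y = trace_of A \<theta> v" "v \<in> lists A"
    unfolding carrier_trace_monoid by blast
  then show "x \<otimes>\<^bsub>trace_monoid A \<theta>\<^esub> y \<in> carrier (trace_monoid A \<theta>)"
    unfolding carrier_trace_monoid by (metis append_in_lists_conv imageI trace_of_mult)
next
  show "\<one>\<^bsub>trace_monoid A \<theta>\<^esub> \<in> carrier (trace_monoid A \<theta>)"
    unfolding carrier_trace_monoid one_trace_monoid by blast
next
  fix x y z
  assume "x \<in> carrier (trace_monoid A \<theta>)" "y \<in> carrier (trace_monoid A \<theta>)"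
    "z \<in> carrier (trace_monoid A \<theta>)"
  then obtain u v w where "x = trace_of A \<theta> u" "u \<in> lists A" "y = trace_of A \<theta> v" "v \<in> lists A"
    "z = trace_of A \<theta> w" "w \<in> lists A"
    unfolding carrier_trace_monoid by blast
  then show "x \<otimes>\<^bsub>trace_monoid A \<theta>\<^esub> y \<otimes>\<^bsub>trace_monoid A \<theta>\<^esub> z =
      x \<otimes>\<^bsub>trace_monoid A \<theta>\<^esub> (y \<otimes>\<^bsub>trace_monoid A \<theta>\<^esub> z)"
    by (simp only: trace_of_mult append_in_lists_conv append_assoc simp_thms)
next
  fix x
  assume "x \<in> carrier (trace_monoid A \<theta>)"
  then obtain u where "x = trace_of A \<theta> u" "u \<in> lists A"
    unfolding carrier_trace_monoid by blast
  then show "\<one>\<^bsub>trace_monoid A \<theta>\<^esub> \<otimes>\<^bsub>trace_monoid A \<theta>\<^esub> x = x"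
    "x \<otimes>\<^bsub>trace_monoid A \<theta>\<^esub> \<one>\<^bsub>trace_monoid A \<theta>\<^esub> = x"
    by (simp_all only: one_trace_monoid trace_of_mult lists.Nil append_Nil append_Nil2)
qed

lemma Alph_trace_of:
  assumes "u \<in> lists A"
  shows "Alph (trace_of A \<theta> u) = set u"
proof -
  have "set v = set w" if "(v, w) \<in> trace_cong A \<theta>" for v w
    using that by (induction rule: trace_cong.induct) auto
  then have "set v = set u" if "v \<in> trace_of A \<theta> u" for v
    using that unfolding mem_trace_of_iff by blast
  moreover have "u \<in> trace_of A \<theta> u"
    using assms by (simp only: mem_trace_of_iff trace_cong.refl)
  ultimately show ?thesis unfolding Alph_def by blast
qed

lemma trace_mult_commute:
  assumes "u \<in> lists A" "v \<in> lists A" "set u \<times> set v \<subseteq> \<theta>"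
  shows "(u @ v, v @ u) \<in> trace_cong A \<theta>"
proof -
  have step: "([a] @ v, v @ [a]) \<in> trace_cong A \<theta>"
    if "a \<in> A" "v \<in> lists A" "{a} \<times> set v \<subseteq> \<theta>" for a v
    using that
  proof (induction v)
    case Nil
    then show ?case by (simp add: trace_cong.refl)
  next
    case (Cons b v)
    have "([a] @ b # v, [b] @ a # v) \<in> trace_cong A \<theta>"
      using Cons.prems trace_cong.comm[of a A b \<theta> "[]" v] by simp
    moreover have "([b] @ a # v, [b] @ v @ [a]) \<in> trace_cong A \<theta>"
      using Cons trace_cong_append_left[of "[a] @ v" "v @ [a]" A \<theta> "[b]"] by simp
    ultimately show ?case using trace_cong.trans by fastforce
  qed
  show ?thesis
    using assms
  proof (induction u)
    case Nil
    then show ?case by (simp add: trace_cong.refl)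
  next
    case (Cons a u)
    have "([a] @ u @ v, [a] @ v @ u) \<in> trace_cong A \<theta>"
      using Cons by (intro trace_cong_append_left) auto
    moreover have "(([a] @ v) @ u, (v @ [a]) @ u) \<in> trace_cong A \<theta>"
      using Cons.hyps Cons.prems by (intro trace_cong_append_right step) auto
    ultimately show ?case using trace_cong.trans by fastforce
  qed
qed

lemma word_product_closed:
  "monoid G \<Longrightarrow> xs \<in> lists (carrier G) \<Longrightarrow> word_product G xs \<in> carrier G"
  by (induction xs) (auto simp: word_product_def monoid.m_closed monoid.one_closed)

lemma word_product_append:
  assumes "monoid G" "xs \<in> lists (carrier G)" "ys \<in> lists (carrier G)"
  shows "word_product G (xs @ ys) = word_product G xs \<otimes>\<^bsub>G\<^esub> word_product G ys"
  using assms(2)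
proof (induction xs)
  case Nil
  then show ?case
    using monoid.l_one[OF assms(1) word_product_closed[OF assms(1,3)]]
    by (simp add: word_product_def)
next
  case (Cons x xs)
  then show ?case
    using monoid.m_assoc[OF assms(1)] word_product_closed[OF assms(1)] assms(3)
    by (simp add: word_product_def)
qed

lemma natural_morphism_trace_of:
  assumes X: "X \<subseteq> carrier (trace_monoid A \<theta>)" and "xs \<in> lists X"
  shows "natural_morphism A \<theta> (trace_of X (induced_independence \<theta> X) xs) =
    word_product (trace_monoid A \<theta>) xs"
proof -
  let ?M = "trace_monoid A \<theta>"
  note M = monoid_trace_monoid[of A \<theta>]
  have swap: "x \<otimes>\<^bsub>?M\<^esub> y = y \<otimes>\<^bsub>?M\<^esub> x"
    if xy: "(x, y) \<in> induced_independence \<theta> X" for x y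
  proof -
    have "x \<in> carrier ?M" "y \<in> carrier ?M" and sub: "Alph x \<times> Alph y \<subseteq> \<theta>"
      using xy X by (auto simp: induced_independence_def)
    then obtain u v where uv: "x = trace_of A \<theta> u" "u \<in> lists A"
      "y = trace_of A \<theta> v" "v \<in> lists A"
      unfolding carrier_trace_monoid by blast
    have "(u @ v, v @ u) \<in> trace_cong A \<theta>"
      using sub uv by (intro trace_mult_commute) (simp_all only: Alph_trace_of)
    then show ?thesis
      using uv by (simp only: trace_of_mult trace_of_eqI)
  qed
  have inv: "word_product ?M us = word_product ?M vs"
    if "(us, vs) \<in> trace_cong X (induced_independence \<theta> X)" for us vs
    using that
  proof (induction rule: trace_cong.induct)
    case (comm x y us vs)
    have L: "us \<in> lists (carrier ?M)" "[x, y] \<in> lists (carrier ?M)"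
      "[y, x] \<in> lists (carrier ?M)" "vs \<in> lists (carrier ?M)"
      using comm X by auto
    have "word_product ?M [x, y] = word_product ?M [y, x]"
      using swap[OF comm(3)] L monoid.r_one[OF M] by (simp add: word_product_def)
    moreover have "zs @ vs \<in> lists (carrier ?M)" if "zs \<in> lists (carrier ?M)" for zs
      using that L by simp
    ultimately show ?case
      using L by (simp only: word_product_append[OF M])
  qed simp_all
  let ?T = "trace_of X (induced_independence \<theta> X) xs"
  have "xs \<in> ?T"
    using assms by (simp only: mem_trace_of_iff trace_cong.refl)
  then have "?T \<noteq> {}"
    by (rule ex_in_conv[THEN iffD1, OF exI])
  moreover have "word_product ?M ys = word_product ?M xs" if "ys \<in> ?T" for ys
    using that unfolding mem_trace_of_iff by (rule inv[symmetric])
  ultimately have "word_product ?M ` ?T = {word_product ?M xs}"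
    by (metis (no_types, lifting) image_cong image_constant_conv)
  then show ?thesis
    unfolding natural_morphism_def by (simp only: the_elem_eq)
qed

end

theory Submission
  imports Defs
begin

text \<open>
  In the language of heaps of pieces, an element of \<open>\<beta>\<^sub>Z(B)\<close> is a pyramid: a trace with a single
  minimal letter, its base \<open>z \<in> Z\<close>, all of whose other letters lie in \<open>B\<close>. As no other letter is
  minimal, every letter \<open>b\<close> of the pyramid is tied to \<open>z\<close> by a chain of dependent letters of \<open>B\<close>
  (lemma \<open>pyramid_linked\<close>).
  The theorem is about the difference between two pyramids whose bases \<open>z\<close>, \<open>z'\<close> commute and
  two pyramids that commute altogether. Condition (iii) says that there is no such difference: a
  dependence between letters of the two pyramids, together with the chains to \<open>z\<close> and \<open>z'\<close>,
  would be a forbidden path (lemma \<open>alph_independent\<close>).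

  The implication (iii) \<open>\<Longrightarrow>\<close> (i) is a greedy comparison of two factorizations \<open>x\<^sub>1 \<cdots> x\<^sub>m = y\<^sub>1 \<cdots> y\<^sub>n\<close>.
  The base \<open>z\<close> of \<open>x\<^sub>1\<close> is initial in the product, so it is the base of some \<open>y\<^sub>j\<close> and
  commutes with \<open>y\<^sub>1, \<dots>, y\<^sub>j\<^sub>-\<^sub>1\<close> (lemma \<open>initial_factor\<close>); by (iii) all of \<open>y\<^sub>j\<close> commutes with them
  and moves to the front. Then \<open>x\<^sub>1 = y\<^sub>j\<close>: after \<open>z\<close> is cancelled, the \<open>B\<close>-part
  of the first pyramid is the largest left factor over \<open>B\<close>, because a product of pyramids has no initial
  letter in \<open>B\<close> (lemma \<open>subalphabet_prefix_unique\<close>). Left cancellation and induction finish.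

  For (i) \<open>\<Longrightarrow>\<close> (ii), the two sides in (ii) are products of two code elements each, so the code
  property makes the factors agree, the base telling which is which.
  For (ii) \<open>\<Longrightarrow>\<close> (iii), a path \<open>z - b\<^sub>1 - \<dots> - b\<^sub>n - z'\<close> is cut at its first \<open>b\<^sub>n\<close> that depends on \<open>z'\<close>;
  then \<open>z b\<^sub>1 \<cdots> b\<^sub>n\<^sub>-\<^sub>1 \<cdot> z' b\<^sub>n = z' \<cdot> z b\<^sub>1 \<cdots> b\<^sub>n\<close> violates (ii).
\<close>

section \<open>Initial letters and cancellation\<close>

text \<open>The word-level form of \<open>IA\<close>: the letter \<open>a\<close> can be brought to the front.\<close>

primrec initial :: "('a \<times> 'a) set \<Rightarrow> 'a \<Rightarrow> 'a list \<Rightarrow> bool" where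
  "initial \<theta> a [] \<longleftrightarrow> False"
| "initial \<theta> a (x # u) \<longleftrightarrow> a = x \<or> (a, x) \<in> \<theta> \<and> initial \<theta> a u"

lemma initial_append:
  "initial \<theta> a (u @ v) \<longleftrightarrow> initial \<theta> a u \<or> {a} \<times> set u \<subseteq> \<theta> \<and> initial \<theta> a v"
  by (induction u) auto

lemma initial_mem: "initial \<theta> a u \<Longrightarrow> a \<in> set u"
  by (induction u) auto

locale trace_alphabet =
  fixes A :: "'a set" and \<theta> :: "('a \<times> 'a) set"
  assumes alphabet: "independence_alphabet A \<theta>"
begin

abbreviation M where "M \<equiv> trace_monoid A \<theta>"
abbreviation tr where "tr \<equiv> trace_of A \<theta>"
abbreviation tmult (infixl "\<cdot>" 70) where "s \<cdot> t \<equiv> s \<otimes>\<^bsub>M\<^esub> t"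
abbreviation cong_words (infix "\<sim>" 50) where "u \<sim> v \<equiv> (u, v) \<in> trace_cong A \<theta>"

lemma sym_indep: "(a, b) \<in> \<theta> \<Longrightarrow> (b, a) \<in> \<theta>"
  using alphabet unfolding independence_alphabet_def by (blast dest: symD)

lemma irrefl_indep: "(a, a) \<notin> \<theta>"
  using alphabet unfolding independence_alphabet_def by (blast dest: irreflD)

lemma initial_cong: "u \<sim> v \<Longrightarrow> initial \<theta> a u \<longleftrightarrow> initial \<theta> a v"
  by (induction rule: trace_cong.induct) (auto simp: initial_append sym_indep)

text \<open>Two letters that may be swapped are distinct, so a swap never exchanges two occurrences of
  the same letter; hence deleting the first occurrence is compatible with the congruence.\<close>

lemma remove1_cong: "u \<sim> v \<Longrightarrow> remove1 a u \<sim> remove1 a v"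
proof (induction rule: trace_cong.induct)
  case (refl u)
  then show ?case using set_remove1_subset[of a u] by (intro trace_cong.refl) auto
next
  case (comm x y u v)
  have L: "remove1 a u \<in> lists A" "remove1 a v \<in> lists A"
    using comm set_remove1_subset[of a u] set_remove1_subset[of a v] by auto
  have "x \<noteq> y" using comm irrefl_indep by auto
  then show ?case
    using comm L trace_cong.comm[of x A y \<theta> "remove1 a u" v]
      trace_cong.comm[of x A y \<theta> u "remove1 a v"]
    by (auto simp: remove1_append intro!: trace_cong.refl)
qed (blast intro: trace_cong.sym trace_cong.trans)+

lemma Cons_remove1_cong: "u \<in> lists A \<Longrightarrow> initial \<theta> a u \<Longrightarrow> a # remove1 a u \<sim> u"
proof (induction u)
  case (Cons x u)
  show ?case
  proof (cases "a = x")
    case True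
    then show ?thesis using Cons.prems by (auto intro!: trace_cong.refl)
  next
    case False
    with Cons.prems have ax: "(a, x) \<in> \<theta>" "initial \<theta> a u" by auto
    have A: "a \<in> A" "x \<in> A" using Cons.prems initial_mem[OF ax(2)] by auto
    have "remove1 a u \<in> lists A" using Cons.prems set_remove1_subset[of a u] by auto
    then have "a # x # remove1 a u \<sim> x # a # remove1 a u"
      using trace_cong.comm[of a A x \<theta> "[]" "remove1 a u"] A ax by simp
    moreover have "x # a # remove1 a u \<sim> x # u"
      using trace_cong_append_left[of "a # remove1 a u" u A \<theta> "[x]"] Cons ax by simp
    ultimately show ?thesis using False trace_cong.trans by fastforce
  qed
qed simp

lemma append_left_cancel_cong: "s @ u \<sim> s @ v \<Longrightarrow> u \<sim> v"
proof (induction s)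
  case (Cons a s)
  then show ?case using remove1_cong[of "a # s @ u" "a # s @ v" a] by simp
qed simp

lemma trace_cases:
  assumes "t \<in> carrier M"
  obtains u where "u \<in> lists A" "t = tr u"
  using assms unfolding carrier_trace_monoid by blast

lemma tr_in_carrier: "u \<in> lists A \<Longrightarrow> tr u \<in> carrier M"
  unfolding carrier_trace_monoid by blast

lemmas mult_closed = monoid.m_closed[OF monoid_trace_monoid[of A \<theta>]]
lemmas mult_assoc = monoid.m_assoc[OF monoid_trace_monoid[of A \<theta>]]

lemma IA_tr:
  assumes u: "u \<in> lists A"
  shows "IA A \<theta> (tr u) = {a. initial \<theta> a u}"
proof (intro subset_antisym subsetI)
  fix a assume "a \<in> IA A \<theta> (tr u)"
  then obtain w where a: "a \<in> A" and w: "w \<in> carrier M" "tr u = tr [a] \<cdot> w"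
    unfolding IA_def by blast
  obtain v where v: "v \<in> lists A" "w = tr v" using trace_cases[OF w(1)] .
  have "tr u = tr (a # v)" using w(2) v a by (simp add: trace_of_mult)
  then have "u \<sim> a # v" using trace_of_eq_iff[of u A "a # v" \<theta>] u v a by simp
  then show "a \<in> {a. initial \<theta> a u}" using initial_cong by simp
next
  fix a assume "a \<in> {a. initial \<theta> a u}"
  then have a: "initial \<theta> a u" by simp
  have L: "remove1 a u \<in> lists A" using u set_remove1_subset[of a u] by auto
  have aA: "a \<in> A" using initial_mem[OF a] u by auto
  have "tr u = tr (a # remove1 a u)"
    using trace_of_eqI[OF Cons_remove1_cong[OF u a]] by simp
  then have "tr u = tr [a] \<cdot> tr (remove1 a u)"
    using trace_of_mult[of "[a]" A "remove1 a u" \<theta>] aA L by simp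
  then show "a \<in> IA A \<theta> (tr u)"
    unfolding IA_def using aA tr_in_carrier[OF L] by blast
qed

lemma IA_one: "IA A \<theta> \<one>\<^bsub>M\<^esub> = {}"
  by (simp add: one_trace_monoid IA_tr)

lemma IA_mult:
  assumes "s \<in> carrier M" "t \<in> carrier M"
  shows "a \<in> IA A \<theta> (s \<cdot> t) \<longleftrightarrow>
    a \<in> IA A \<theta> s \<or> {a} \<times> Alph s \<subseteq> \<theta> \<and> a \<in> IA A \<theta> t"
proof -
  obtain u where u: "u \<in> lists A" "s = tr u" using trace_cases[OF assms(1)] .
  obtain v where v: "v \<in> lists A" "t = tr v" using trace_cases[OF assms(2)] .
  have uv: "u @ v \<in> lists A" using u v by simp
  have "s \<cdot> t = tr (u @ v)" using u v by (simp only: trace_of_mult)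
  then show ?thesis
    using IA_tr[OF uv] IA_tr[OF u(1)] IA_tr[OF v(1)] Alph_trace_of[OF u(1)] u v
    by (simp add: initial_append)
qed

lemma mult_left_cancel:
  assumes "s \<in> carrier M" "t \<in> carrier M" "t' \<in> carrier M" "s \<cdot> t = s \<cdot> t'"
  shows "t = t'"
proof -
  obtain r where r: "r \<in> lists A" "s = tr r" using trace_cases[OF assms(1)] .
  obtain u where u: "u \<in> lists A" "t = tr u" using trace_cases[OF assms(2)] .
  obtain v where v: "v \<in> lists A" "t' = tr v" using trace_cases[OF assms(3)] .
  have "tr (r @ u) = tr (r @ v)" using assms(4) r u v by (simp only: trace_of_mult)
  then have "r @ u \<sim> r @ v" using trace_of_eq_iff[of "r @ u" A "r @ v" \<theta>] r u v by simp
  then show ?thesis using append_left_cancel_cong u v by (simp add: trace_of_eqI)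
qed

section \<open>Partially commutative codes in terms of words\<close>

lemma word_product_cong:
  assumes X: "X \<subseteq> carrier M" and "(xs, ys) \<in> trace_cong X (induced_independence \<theta> X)"
  shows "word_product M xs = word_product M ys"
  using natural_morphism_trace_of[OF X] trace_cong_lists[OF assms(2)] trace_of_eqI[OF assms(2)]
  by metis

lemma submonoid_generated_eq_word_products:
  assumes X: "X \<subseteq> carrier M"
  shows "submonoid_generated M X = word_product M ` lists X"
proof (intro subset_antisym subsetI)
  fix t assume "t \<in> submonoid_generated M X"
  then show "t \<in> word_product M ` lists X"
  proof induction
    case one
    have "\<one>\<^bsub>M\<^esub> = word_product M []" by (simp add: word_product_def)
    then show ?case by blast
  next
    case (incl x)
    then have "x = word_product M [x]"
      using X by (auto simp: word_product_def monoid.r_one[OF monoid_trace_monoid])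
    moreover have "[x] \<in> lists X" using incl by simp
    ultimately show ?case by blast
  next
    case (mult x y)
    then obtain xs ys where "xs \<in> lists X" "ys \<in> lists X"
      "x = word_product M xs" "y = word_product M ys" by blast
    moreover from this have "xs @ ys \<in> lists X" by simp
    moreover have "lists X \<subseteq> lists (carrier M)" using X by (rule lists_mono)
    ultimately show ?case
      by (metis (no_types, lifting) imageI subsetD word_product_append[OF monoid_trace_monoid])
  qed
next
  fix t assume "t \<in> word_product M ` lists X"
  then obtain xs where "xs \<in> lists X" "t = word_product M xs" by blast
  then show "t \<in> submonoid_generated M X"
  proof (induction xs arbitrary: t rule: list.induct)
    case Nil
    then show ?case using submonoid_generated.one[of M X] by (simp add: word_product_def)
  next
    case (Cons x xs)
    then have "x \<in> X" "word_product M xs \<in> submonoid_generated M X"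
      by (auto simp del: in_lists_conv_set)
    then have "x \<cdot> word_product M xs \<in> submonoid_generated M X"
      using submonoid_generated.mult submonoid_generated.incl by metis
    then show ?case using Cons.prems(2) by (simp add: word_product_def)
  qed
qed

text \<open>The natural morphism is always a surjective homomorphism, so a code is characterized by its
  injectivity alone.\<close>

lemma partially_commutative_code_iff:
  assumes X: "X \<subseteq> carrier M"
  shows "partially_commutative_code A \<theta> X \<longleftrightarrow>
    (\<forall>xs \<in> lists X. \<forall>ys \<in> lists X. word_product M xs = word_product M ys \<longrightarrow>
      (xs, ys) \<in> trace_cong X (induced_independence \<theta> X))"
proof -
  let ?I = "induced_independence \<theta> X"
  let ?N = "trace_monoid X ?I"
  let ?S = "M\<lparr>carrier := submonoid_generated M X\<rparr>"
  let ?f = "natural_morphism A \<theta>"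
  note f = natural_morphism_trace_of[OF X]
  have L: "lists X \<subseteq> lists (carrier M)" using X by (rule lists_mono)
  have image: "?f ` carrier ?N = carrier ?S"
    unfolding carrier_trace_monoid submonoid_generated_eq_word_products[OF X]
    by (auto simp: image_image f)
  have hom: "?f \<in> hom ?N ?S"
  proof (rule homI)
    fix s assume "s \<in> carrier ?N"
    then show "?f s \<in> carrier ?S" using image by blast
  next
    fix s t assume "s \<in> carrier ?N" "t \<in> carrier ?N"
    then obtain xs ys where st: "s = trace_of X ?I xs" "t = trace_of X ?I ys"
      and xy: "xs \<in> lists X" "ys \<in> lists X"
      unfolding carrier_trace_monoid by blast
    have "s \<otimes>\<^bsub>?N\<^esub> t = trace_of X ?I (xs @ ys)" using st xy by (simp only: trace_of_mult)
    moreover have "xs @ ys \<in> lists X" using xy by simp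
    ultimately have "?f (s \<otimes>\<^bsub>?N\<^esub> t) = word_product M (xs @ ys)" by (simp only: f)
    also have "\<dots> = word_product M xs \<cdot> word_product M ys"
      using xy L by (intro word_product_append[OF monoid_trace_monoid]) blast+
    finally show "?f (s \<otimes>\<^bsub>?N\<^esub> t) = ?f s \<otimes>\<^bsub>?S\<^esub> ?f t" using st xy by (simp add: f)
  qed
  have "partially_commutative_code A \<theta> X \<longleftrightarrow> inj_on ?f (carrier ?N)"
    unfolding partially_commutative_code_def iso_def bij_betw_def using X hom image by simp
  also have "\<dots> \<longleftrightarrow> (\<forall>xs \<in> lists X. \<forall>ys \<in> lists X. word_product M xs = word_product M ys \<longrightarrow>
      trace_of X ?I xs = trace_of X ?I ys)"
    unfolding inj_on_def carrier_trace_monoid by (simp add: f del: in_lists_conv_set)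
  also have "\<dots> \<longleftrightarrow> (\<forall>xs \<in> lists X. \<forall>ys \<in> lists X. word_product M xs = word_product M ys \<longrightarrow>
      (xs, ys) \<in> trace_cong X ?I)"
    by (simp add: trace_of_eq_iff del: in_lists_conv_set)
  finally show ?thesis .
qed

end

section \<open>Pyramids over a subalphabet\<close>

locale subalphabet = trace_alphabet +
  fixes B :: "'a set"
  assumes B: "B \<subseteq> A"
begin

abbreviation X where "X \<equiv> beta A \<theta> B"
abbreviation dep where "dep \<equiv> dependence_edges A \<theta>"

lemma subalphabet_traces_eq: "subalphabet_traces A \<theta> B = tr ` lists B"
proof (intro subset_antisym subsetI)
  fix t assume "t \<in> subalphabet_traces A \<theta> B"
  then show "t \<in> tr ` lists B"
    unfolding subalphabet_traces_def
  proof induction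
    case one
    then show ?case unfolding one_trace_monoid by blast
  next
    case (incl x)
    then obtain b where "b \<in> B" "x = tr [b]" by blast
    moreover from this have "[b] \<in> lists B" by simp
    ultimately show ?case by blast
  next
    case (mult x y)
    then obtain u v where uv: "u \<in> lists B" "v \<in> lists B" "x = tr u" "y = tr v" by blast
    then have "x \<cdot> y = tr (u @ v)"
      using lists_mono[OF B] by (metis subsetD trace_of_mult)
    then show ?case using uv by (metis append_in_lists_conv imageI)
  qed
next
  fix t assume "t \<in> tr ` lists B"
  then obtain u where "u \<in> lists B" "t = tr u" by blast
  then show "t \<in> subalphabet_traces A \<theta> B"
  proof (induction u arbitrary: t rule: list.induct)
    case Nil
    then show ?case
      unfolding subalphabet_traces_def using submonoid_generated.one one_trace_monoid by metis
  next
    case (Cons b u)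
    then have "b \<in> B" "u \<in> lists B" by auto
    then have "tr (b # u) = tr [b] \<cdot> tr u"
      using B lists_mono[OF B] trace_of_mult[of "[b]" A u \<theta>] by auto
    moreover have "tr [b] \<in> subalphabet_traces A \<theta> B"
      unfolding subalphabet_traces_def using \<open>b \<in> B\<close> by (intro submonoid_generated.incl) blast
    moreover have "tr u \<in> subalphabet_traces A \<theta> B" using Cons.IH \<open>u \<in> lists B\<close> by blast
    ultimately show ?case
      using Cons.prems submonoid_generated.mult unfolding subalphabet_traces_def by metis
  qed
qed

lemma lists_B: "w \<in> lists B \<Longrightarrow> w \<in> lists A"
  using B by auto

lemma letter_mult_tr:
  "z \<in> A \<Longrightarrow> w \<in> lists B \<Longrightarrow> tr [z] \<cdot> tr w = tr (z # w)"
  using trace_of_mult[of "[z]" A w \<theta>] lists_B by simp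

lemma beta_cases:
  assumes "x \<in> X"
  obtains z w where "z \<in> A - B" "w \<in> lists B" "x = tr (z # w)" "IA A \<theta> x = {z}"
proof -
  obtain z w where z: "z \<in> A - B" and w: "w \<in> subalphabet_traces A \<theta> B"
    and x: "x = tr [z] \<cdot> w" "IA A \<theta> (tr [z] \<cdot> w) = {z}"
    using assms unfolding beta_def by blast
  obtain u where u: "u \<in> lists B" "w = tr u"
    using w unfolding subalphabet_traces_eq by blast
  show ?thesis using that[OF z u(1)] x u letter_mult_tr[of z u] z by simp
qed

lemma beta_subset_carrier: "X \<subseteq> carrier M"
proof
  fix x assume "x \<in> X"
  then obtain z w where "z \<in> A - B" "w \<in> lists B" "x = tr (z # w)" by (rule beta_cases)
  then show "x \<in> carrier M" using tr_in_carrier[of "z # w"] lists_B by simp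
qed

lemma word_product_beta_closed:
  "xs \<in> lists X \<Longrightarrow> word_product M xs \<in> carrier M"
  using word_product_closed[OF monoid_trace_monoid] lists_mono[OF beta_subset_carrier] by blast

lemma word_product_Cons: "word_product M (x # xs) = x \<cdot> word_product M xs"
  by (simp add: word_product_def)

lemma TFSA_iff:
  "TFSA A \<theta> B \<longleftrightarrow>
    (\<forall>xs \<in> lists X. \<forall>ys \<in> lists X. word_product M xs = word_product M ys \<longrightarrow>
      (xs, ys) \<in> trace_cong X (induced_independence \<theta> X))"
  unfolding TFSA_def by (rule partially_commutative_code_iff[OF beta_subset_carrier])

subsection \<open>Greedy comparison of factorizations\<close>

text \<open>A letter of \<open>B\<close> is kept from the front by the base of the pyramid that contains it.\<close>

lemma no_initial_in_B:
  assumes "xs \<in> lists X"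
  shows "IA A \<theta> (word_product M xs) \<inter> B = {}"
  using assms
proof (induction xs rule: list.induct)
  case Nil
  then show ?case by (simp add: word_product_def IA_one)
next
  case (Cons x xs)
  then have x: "x \<in> X" and xs: "xs \<in> lists X" by auto
  obtain z where "z \<in> A - B" "IA A \<theta> x = {z}" using x by (elim beta_cases) blast
  moreover have "x \<in> carrier M" using x beta_subset_carrier by blast
  ultimately show ?case
    using IA_mult[OF _ word_product_beta_closed[OF xs], of x] Cons.IH[OF xs]
    unfolding word_product_Cons by auto
qed

text \<open>A letter of \<open>B\<close> that is initial in \<open>w \<cdot> x\<^sub>1 \<cdots> x\<^sub>n\<close> cannot come from the pyramids, hence it comes
  from \<open>w\<close>; peeling off such letters one by one recovers \<open>w\<close> from the product.\<close>

lemma subalphabet_prefix_unique: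
  assumes "u \<in> lists B" "v \<in> lists B" "xs \<in> lists X" "ys \<in> lists X"
    and "tr u \<cdot> word_product M xs = tr v \<cdot> word_product M ys"
  shows "tr u = tr v"
  using assms(1,2,5)
proof (induction u arbitrary: v rule: list.induct)
  case Nil
  have P: "word_product M xs \<in> carrier M" using word_product_beta_closed[OF assms(3)] .
  have eq: "word_product M xs = tr v \<cdot> word_product M ys"
    using Nil.prems(3) monoid.l_one[OF monoid_trace_monoid P]
    by (simp add: one_trace_monoid)
  have "v = []"
  proof (rule ccontr)
    assume "v \<noteq> []"
    then have "initial \<theta> (hd v) v" "hd v \<in> B" using Nil.prems(2) by (cases v; simp)+
    then have "hd v \<in> IA A \<theta> (word_product M xs) \<inter> B"
      unfolding eq
      using IA_mult[OF tr_in_carrier[OF lists_B[OF Nil.prems(2)]]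
          word_product_beta_closed[OF assms(4)]] IA_tr[OF lists_B[OF Nil.prems(2)]]
      by simp
    then show False using no_initial_in_B[OF assms(3)] by blast
  qed
  then show ?case by simp
next
  case (Cons b u)
  have b: "b \<in> B" "b \<in> A" and u: "u \<in> lists B" using Cons.prems(1) B by auto
  have bu: "tr (b # u) = tr [b] \<cdot> tr u" using letter_mult_tr[of b u] b u by simp
  have C: "tr [b] \<in> carrier M" "tr u \<in> carrier M" "tr v \<in> carrier M"
    "word_product M xs \<in> carrier M" "word_product M ys \<in> carrier M"
    using b tr_in_carrier[of "[b]"] tr_in_carrier[OF lists_B[OF u]]
      tr_in_carrier[OF lists_B[OF Cons.prems(2)]]
      word_product_beta_closed[OF assms(3)] word_product_beta_closed[OF assms(4)]
    by simp_all
  have "b \<in> IA A \<theta> (tr (b # u))"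
    using IA_tr[of "b # u"] lists_B[OF Cons.prems(1)] by simp
  then have "b \<in> IA A \<theta> (tr (b # u) \<cdot> word_product M xs)"
    using IA_mult[OF tr_in_carrier[OF lists_B[OF Cons.prems(1)]] C(4)] by blast
  then have "b \<in> IA A \<theta> (tr v \<cdot> word_product M ys)"
    using Cons.prems(3) by simp
  then have "b \<in> IA A \<theta> (tr v)"
    using IA_mult[OF C(3,5)] no_initial_in_B[OF assms(4)] b by blast
  then have init: "initial \<theta> b v" using IA_tr[OF lists_B[OF Cons.prems(2)]] by simp
  define v' where "v' = remove1 b v"
  have v': "v' \<in> lists B" using Cons.prems(2) set_remove1_subset[of b v] by (auto simp: v'_def)
  have bv: "tr v = tr [b] \<cdot> tr v'"
    using letter_mult_tr[OF b(2) v']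
      trace_of_eqI[OF Cons_remove1_cong[OF lists_B[OF Cons.prems(2)] init]]
    by (simp add: v'_def)
  have C': "tr v' \<in> carrier M" using v' lists_B tr_in_carrier by blast
  have "tr [b] \<cdot> (tr u \<cdot> word_product M xs) = tr [b] \<cdot> (tr v' \<cdot> word_product M ys)"
    using Cons.prems(3) C C' unfolding bu bv by (simp add: mult_assoc)
  then have "tr u \<cdot> word_product M xs = tr v' \<cdot> word_product M ys"
    by (rule mult_left_cancel[OF C(1) mult_closed[OF C(2,4)] mult_closed[OF C' C(5)]])
  then show ?case using Cons.IH[OF u v'] bu bv by simp
qed

text \<open>The base is the only letter of a pyramid outside \<open>B\<close>, so an initial letter \<open>z \<notin> B\<close> of a product
  must be the base of the first factor in which it occurs.\<close>

lemma initial_factor: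
  assumes "ys \<in> lists X" "z \<in> IA A \<theta> (word_product M ys)"
  shows "\<exists>ys1 y ys2. ys = ys1 @ y # ys2 \<and> IA A \<theta> y = {z} \<and>
    (\<forall>y' \<in> set ys1. {z} \<times> Alph y' \<subseteq> \<theta>)"
  using assms
proof (induction ys rule: list.induct)
  case Nil
  then show ?case by (simp add: word_product_def IA_one)
next
  case (Cons y ys)
  then have y: "y \<in> X" and ys: "ys \<in> lists X" by auto
  have yC: "y \<in> carrier M" using y beta_subset_carrier by blast
  consider "z \<in> IA A \<theta> y" | "{z} \<times> Alph y \<subseteq> \<theta>" "z \<in> IA A \<theta> (word_product M ys)"
    using Cons.prems(2) IA_mult[OF yC word_product_beta_closed[OF ys]] word_product_Cons by auto
  then show ?case
  proof cases
    case 1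
    then have "IA A \<theta> y = {z}" using y by (elim beta_cases) auto
    then show ?thesis by (intro exI[of _ "[]"]) auto
  next
    case 2
    then obtain ys1 y' ys2 where "ys = ys1 @ y' # ys2" "IA A \<theta> y' = {z}"
      "\<forall>y' \<in> set ys1. {z} \<times> Alph y' \<subseteq> \<theta>"
      using Cons.IH[OF ys] by blast
    then show ?thesis using 2(1) by (intro exI[of _ "y # ys1"]) auto
  qed
qed

subsection \<open>Chains of dependent letters\<close>

lemma dep_iff: "(a, b) \<in> dep \<longleftrightarrow> a \<in> A \<and> b \<in> A \<and> a \<noteq> b \<and> (a, b) \<notin> \<theta>"
  unfolding dependence_edges_def by auto

lemma dep_sym: "(a, b) \<in> dep \<Longrightarrow> (b, a) \<in> dep"
  using sym_indep by (auto simp: dep_iff)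

text \<open>The letters of \<open>B\<close> that can follow \<open>z\<close> in a pyramid: those joined to a neighbour \<open>c\<close> of \<open>z\<close>
  by a path inside \<open>B\<close>.\<close>

definition linked :: "'a \<Rightarrow> 'a \<Rightarrow> bool" where
  "linked z b \<longleftrightarrow> (\<exists>c \<in> B. (z, c) \<in> dep \<and> (c, b) \<in> (dep \<inter> B \<times> B)\<^sup>*)"

text \<open>A first occurrence of \<open>b\<close> that commutes with everything before it would make \<open>b\<close> initial.
  In a pyramid it therefore depends on an earlier letter, which is linked to \<open>z\<close> by
  induction.\<close>

lemma pyramid_linked:
  assumes z: "z \<in> A - B" and w: "w \<in> lists B" and IA: "IA A \<theta> (tr (z # w)) = {z}"
    and b: "b \<in> set w"
  shows "linked z b"
proof -
  have zw: "z # w \<in> lists A" using z w lists_B by auto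
  have only: "a = z" if "initial \<theta> a (z # w)" for a
    using that IA unfolding IA_tr[OF zw] by blast
  have "\<forall>b \<in> set u. linked z b" if "w = u @ v" for u v
    using that
  proof (induction u arbitrary: v rule: rev_induct)
    case (snoc b u)
    have IH: "\<forall>c \<in> set u. linked z c" using snoc.IH[of "b # v"] snoc.prems by simp
    have b: "b \<in> B" "b \<in> A" "b \<noteq> z" using snoc.prems w z B by auto
    have uB: "set u \<subseteq> B" using snoc.prems w by auto
    have "linked z b" if "b \<notin> set u"
    proof -
      have "\<not> initial \<theta> b (z # u @ [b] @ v)" using only b snoc.prems by auto
      then have "\<not> {b} \<times> set (z # u) \<subseteq> \<theta>" using b by (auto simp: initial_append)
      then obtain c where c: "c \<in> set (z # u)" "(b, c) \<notin> \<theta>" by auto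
      have cb: "(c, b) \<in> dep"
        using c b that z uB B sym_indep by (auto simp: dep_iff)
      show ?thesis
      proof (cases "c = z")
        case True
        then show ?thesis using cb b unfolding linked_def by blast
      next
        case False
        then have "c \<in> B" "linked z c" using c uB IH by auto
        then show ?thesis using cb b unfolding linked_def
          by (meson IntI SigmaI rtrancl.rtrancl_into_rtrancl)
      qed
    qed
    then show ?case using IH by auto
  qed simp
  from this[of w "[]"] show ?thesis using b by simp
qed

definition bridged :: "'a \<Rightarrow> 'a \<Rightarrow> bool" where
  "bridged z z' \<longleftrightarrow>
    (\<exists>bs. bs \<noteq> [] \<and> set bs \<subseteq> B \<and> successively (\<lambda>x y. (x, y) \<in> dep) (z # bs @ [z']))"

lemma rtrancl_path:
  assumes "(c, d) \<in> (dep \<inter> B \<times> B)\<^sup>*" "c \<in> B"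
  shows "\<exists>bs. bs \<noteq> [] \<and> hd bs = c \<and> last bs = d \<and> set bs \<subseteq> B \<and>
    successively (\<lambda>x y. (x, y) \<in> dep) bs"
  using assms(1)
proof (induction rule: rtrancl_induct)
  case base
  then show ?case using assms(2) by (intro exI[of _ "[c]"]) auto
next
  case (step d e)
  then obtain bs where "bs \<noteq> []" "hd bs = c" "last bs = d" "set bs \<subseteq> B"
    "successively (\<lambda>x y. (x, y) \<in> dep) bs" by blast
  then show ?case using step.hyps(2)
    by (intro exI[of _ "bs @ [e]"]) (auto simp: successively_append_iff)
qed

lemma linked_bridged:
  assumes "linked z b" "linked z' b'" "b = b' \<or> (b, b') \<in> dep" "b \<in> B" "b' \<in> B"
  shows "bridged z z'"
proof -
  let ?E = "dep \<inter> B \<times> B"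
  obtain c c' where c: "c \<in> B" "(z, c) \<in> dep" "(c, b) \<in> ?E\<^sup>*"
    and c': "c' \<in> B" "(z', c') \<in> dep" "(c', b') \<in> ?E\<^sup>*"
    using assms(1,2) unfolding linked_def by blast
  have "Relation.sym ?E" using dep_sym by (auto intro!: symI)
  then have "(b', c') \<in> ?E\<^sup>*" using c'(3) by (meson sym_rtrancl symD)
  moreover have "(b, b') \<in> ?E\<^sup>*" using assms(3-5) by blast
  ultimately have "(c, c') \<in> ?E\<^sup>*" using c(3) by (meson rtrancl_trans)
  then obtain bs where "bs \<noteq> []" "hd bs = c" "last bs = c'" "set bs \<subseteq> B"
    "successively (\<lambda>x y. (x, y) \<in> dep) bs"
    using rtrancl_path c(1) by blast
  then show ?thesis unfolding bridged_def using c(2) dep_sym[OF c'(2)]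
    by (intro exI[of _ bs]) (auto simp: successively_append_iff successively_Cons)
qed

text \<open>A letter \<open>b\<close> of the first pyramid and a letter \<open>c\<close> of the second that do not commute are equal
  or dependent; either way the chains from the bases to \<open>b\<close> and \<open>c\<close> join to a path between
  the bases.\<close>

lemma alph_independent:
  assumes y: "y \<in> X" "IA A \<theta> y = {z}" and y': "y' \<in> X"
    and comm: "{z} \<times> Alph y' \<subseteq> \<theta>"
    and no_path: "\<And>z'. z' \<in> A - B \<Longrightarrow> (z, z') \<in> \<theta> \<Longrightarrow> \<not> bridged z z'"
  shows "Alph y \<times> Alph y' \<subseteq> \<theta>"
proof -
  obtain w where z: "z \<in> A - B" and w: "w \<in> lists B" and yw: "y = tr (z # w)"
    using y by (elim beta_cases) auto
  obtain z' w' where z': "z' \<in> A - B" and w': "w' \<in> lists B" and yw': "y' = tr (z' # w')"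
    and IA': "IA A \<theta> y' = {z'}"
    using y' by (rule beta_cases)
  have L: "z # w \<in> lists A" "z' # w' \<in> lists A" using z w z' w' lists_B by auto
  have Alph: "Alph y = insert z (set w)" "Alph y' = insert z' (set w')"
    using Alph_trace_of[OF L(1)] Alph_trace_of[OF L(2)] yw yw' by simp_all
  have zz': "\<not> bridged z z'" using no_path[OF z'] comm Alph by blast
  have linked_z: "linked z b" if "b \<in> set w" for b
    using pyramid_linked[OF z w _ that] y(2) yw by simp
  have linked_z': "linked z' c" if "c \<in> set w'" for c
    using pyramid_linked[OF z' w' _ that] IA' yw' by simp
  have "(b, c) \<in> \<theta>" if b: "b \<in> set w" and c: "c \<in> set w'" for b c
  proof (rule ccontr)
    assume "(b, c) \<notin> \<theta>"
    have bc: "b \<in> B" "c \<in> B" using b c w w' by auto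
    then have "b \<in> A" "c \<in> A" using B by blast+
    then have "b = c \<or> (b, c) \<in> dep" using \<open>(b, c) \<notin> \<theta>\<close> unfolding dep_iff by blast
    then show False using zz' linked_bridged[OF linked_z[OF b] linked_z'[OF c]] bc by simp
  qed
  moreover have "(b, z') \<in> \<theta>" if b: "b \<in> set w" for b
  proof (rule ccontr)
    assume "(b, z') \<notin> \<theta>"
    have bB: "b \<in> B" using b w by blast
    then have "(z', b) \<in> dep" using \<open>(b, z') \<notin> \<theta>\<close> z' B sym_indep by (auto simp: dep_iff)
    then have "linked z' b" using bB unfolding linked_def by blast
    then show False using zz' linked_bridged[OF linked_z[OF b]] bB by simp
  qed
  ultimately have "(b, c) \<in> \<theta>" if "b \<in> Alph y" "c \<in> Alph y'" for b c
    using that comm unfolding Alph by auto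
  then show ?thesis by auto
qed

section \<open>The three implications\<close>

lemma TFSA_if_no_bridge:
  assumes no_path: "\<And>z z'. z \<in> A - B \<Longrightarrow> z' \<in> A - B \<Longrightarrow> (z, z') \<in> \<theta> \<Longrightarrow> \<not> bridged z z'"
  shows "TFSA A \<theta> B"
proof -
  let ?I = "induced_independence \<theta> X"
  have "(xs, ys) \<in> trace_cong X ?I"
    if "xs \<in> lists X" "ys \<in> lists X" "word_product M xs = word_product M ys" for xs ys
    using that
  proof (induction xs arbitrary: ys rule: list.induct)
    case Nil
    have "ys = []"
    proof (rule ccontr)
      assume "ys \<noteq> []"
      then obtain y ys' where ys: "ys = y # ys'" by (cases ys) auto
      then have y: "y \<in> X" "ys' \<in> lists X" using Nil.prems(2) by auto
      have yC: "y \<in> carrier M" using y(1) beta_subset_carrier by blast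
      obtain z where "IA A \<theta> y = {z}" using y(1) by (rule beta_cases)
      then have "z \<in> IA A \<theta> (y \<cdot> word_product M ys')"
        using IA_mult[OF yC word_product_beta_closed[OF y(2)]] by simp
      then show False using Nil.prems(3) ys IA_one by (simp add: word_product_def)
    qed
    then show ?case by (simp add: trace_cong.refl)
  next
    case (Cons x xs)
    have x: "x \<in> X" and xs: "xs \<in> lists X" using Cons.prems(1) by auto
    obtain z u where z: "z \<in> A - B" and u: "u \<in> lists B" and xu: "x = tr (z # u)"
      and IAx: "IA A \<theta> x = {z}"
      using x by (rule beta_cases)
    have xC: "x \<in> carrier M" using x beta_subset_carrier by blast
    have "z \<in> IA A \<theta> (word_product M ys)"
      using IA_mult[OF xC word_product_beta_closed[OF xs]] IAx Cons.prems(3)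
        word_product_Cons by auto
    then obtain ys1 y ys2 where ys: "ys = ys1 @ y # ys2" and IAy: "IA A \<theta> y = {z}"
      and comm: "\<forall>y' \<in> set ys1. {z} \<times> Alph y' \<subseteq> \<theta>"
      using initial_factor[OF Cons.prems(2)] by blast
    have L: "ys1 \<in> lists X" "[y] \<in> lists X" "y \<in> X" "ys2 \<in> lists X" "ys1 @ ys2 \<in> lists X"
      using Cons.prems(2) ys by auto
    \<comment> \<open>The base of \<open>y\<close> commutes with \<open>ys1\<close>; the absence of bridges extends this to all of \<open>y\<close>.\<close>
    have "Alph y \<times> Alph y' \<subseteq> \<theta>" if "y' \<in> set ys1" for y'
    proof (rule alph_independent[OF L(3) IAy])
      show "y' \<in> X" "{z} \<times> Alph y' \<subseteq> \<theta>" using that L(1) comm by auto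
    qed (rule no_path[OF z])
    then have "set [y] \<times> set ys1 \<subseteq> ?I"
      using L unfolding induced_independence_def by auto
    then have "([y] @ ys1, ys1 @ [y]) \<in> trace_cong X ?I"
      using L by (intro trace_mult_commute)
    then have "(([y] @ ys1) @ ys2, (ys1 @ [y]) @ ys2) \<in> trace_cong X ?I"
      using L by (intro trace_cong_append_right)
    then have move: "(y # ys1 @ ys2, ys) \<in> trace_cong X ?I" using ys by simp
    obtain v where v: "v \<in> lists B" and yv: "y = tr (z # v)"
      using L(3) IAy by (elim beta_cases) auto
    have eq: "x \<cdot> word_product M xs = y \<cdot> word_product M (ys1 @ ys2)"
      using Cons.prems(3) word_product_cong[OF beta_subset_carrier move] word_product_Cons
      by metis
    have C: "tr [z] \<in> carrier M" "tr u \<in> carrier M" "tr v \<in> carrier M"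
      "word_product M xs \<in> carrier M" "word_product M (ys1 @ ys2) \<in> carrier M"
      using z tr_in_carrier[of "[z]"] tr_in_carrier[OF lists_B[OF u]]
        tr_in_carrier[OF lists_B[OF v]] word_product_beta_closed[OF xs]
        word_product_beta_closed[OF L(5)] by simp_all
    have split: "x = tr [z] \<cdot> tr u" "y = tr [z] \<cdot> tr v"
      using xu yv letter_mult_tr u v z by auto
    have "tr [z] \<cdot> (tr u \<cdot> word_product M xs) = tr [z] \<cdot> (tr v \<cdot> word_product M (ys1 @ ys2))"
      using eq C unfolding split by (simp add: mult_assoc)
    then have "tr u \<cdot> word_product M xs = tr v \<cdot> word_product M (ys1 @ ys2)"
      by (rule mult_left_cancel[OF C(1) mult_closed[OF C(2,4)] mult_closed[OF C(3,5)]])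
    then have "tr u = tr v" using subalphabet_prefix_unique[OF u v xs L(5)] by blast
    then have xy: "x = y" using split by simp
    then have "word_product M xs = word_product M (ys1 @ ys2)"
      using mult_left_cancel[OF xC C(4,5)] eq by simp
    then have "(xs, ys1 @ ys2) \<in> trace_cong X ?I" using Cons.IH[OF xs L(5)] by blast
    then have "([y] @ xs, [y] @ ys1 @ ys2) \<in> trace_cong X ?I"
      using L by (intro trace_cong_append_left)
    then show ?case using xy move trace_cong.trans by fastforce
  qed
  then show ?thesis unfolding TFSA_iff by blast
qed

text \<open>The two words of length two are congruent over the code, so they have the same letters;
  pyramids over \<open>z1\<close> and \<open>z2\<close> differ by their initial letter, which leaves one way to match them.\<close>

lemma TFSA_exchange_unique:
  assumes TFSA: "TFSA A \<theta> B"
    and z: "z1 \<in> A - B" "z2 \<in> A - B" "z1 \<noteq> z2"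
    and w: "w1 \<in> subalphabet_traces A \<theta> B" "w2 \<in> subalphabet_traces A \<theta> B"
      "w1' \<in> subalphabet_traces A \<theta> B" "w2' \<in> subalphabet_traces A \<theta> B"
    and IA: "IA A \<theta> (tr [z1] \<cdot> w1) = {z1}" "IA A \<theta> (tr [z1] \<cdot> w1') = {z1}"
      "IA A \<theta> (tr [z2] \<cdot> w2) = {z2}" "IA A \<theta> (tr [z2] \<cdot> w2') = {z2}"
    and eq: "tr [z1] \<cdot> w1 \<cdot> tr [z2] \<cdot> w2 = tr [z2] \<cdot> w2' \<cdot> tr [z1] \<cdot> w1'"
  shows "w1 = w1' \<and> w2 = w2'"
proof -
  let ?x1 = "tr [z1] \<cdot> w1" and ?y1 = "tr [z1] \<cdot> w1'"
  let ?x2 = "tr [z2] \<cdot> w2" and ?y2 = "tr [z2] \<cdot> w2'"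
  have X: "?x1 \<in> X" "?y1 \<in> X" "?x2 \<in> X" "?y2 \<in> X"
    unfolding beta_def using z w IA by blast+
  have WC: "w \<in> carrier M" if "w \<in> subalphabet_traces A \<theta> B" for w
    using that lists_B tr_in_carrier unfolding subalphabet_traces_eq by blast
  have C: "tr [z1] \<in> carrier M" "tr [z2] \<in> carrier M" using z by (auto intro: tr_in_carrier)
  note r_one = monoid.r_one[OF monoid_trace_monoid]
  have "word_product M [?x1, ?x2] = word_product M [?y2, ?y1]"
    using eq C WC[OF w(1)] WC[OF w(2)] WC[OF w(3)] WC[OF w(4)]
    by (simp add: word_product_def r_one mult_closed mult_assoc)
  then have "([?x1, ?x2], [?y2, ?y1]) \<in> trace_cong X (induced_independence \<theta> X)"
    using TFSA X unfolding TFSA_iff by simp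
  then have "set [?x1, ?x2] = set [?y2, ?y1]"
    using Alph_trace_of trace_of_eqI trace_cong_lists by metis
  moreover have "?x1 \<noteq> ?y2" "?x2 \<noteq> ?y1" using IA z by auto
  ultimately have "?x1 = ?y1" "?x2 = ?y2" by auto
  then show ?thesis using mult_left_cancel C WC w by blast
qed

text \<open>Each letter of a path is blocked by its predecessor, so only the first can be initial.\<close>

lemma IA_path_trace:
  assumes "z \<in> A" "w \<in> lists A" "successively (\<lambda>x y. (x, y) \<in> dep) (z # w)"
  shows "IA A \<theta> (tr (z # w)) = {z}"
proof -
  have "initial \<theta> a w \<Longrightarrow> (a, y) \<in> \<theta> \<Longrightarrow> False"
    if "successively (\<lambda>x y. (x, y) \<in> dep) (y # w)" for a y
    using that
  proof (induction w arbitrary: y)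
    case (Cons c w)
    then show ?case using sym_indep by (auto simp: dep_iff)
  qed simp
  from this[OF assms(3)] have "initial \<theta> a (z # w) \<longleftrightarrow> a = z" for a by auto
  then show ?thesis using IA_tr[of "z # w"] assms by auto
qed

text \<open>Cutting the path at its first letter \<open>b\<close> dependent on \<open>z'\<close> leaves \<open>z - ps - b - z'\<close> in which
  \<open>z'\<close> commutes with \<open>z\<close> and \<open>ps\<close>. So \<open>b\<close> may be counted to either
  pyramid: \<open>z ps \<cdot> z' b = z' \<cdot> z ps b\<close>, two different factorizations.\<close>

lemma exchange_witness:
  assumes z: "z \<in> A - B" "z' \<in> A - B" "(z, z') \<in> \<theta>" and "bridged z z'"
  obtains w1 w2 w1' w2' where
    "w1 \<in> subalphabet_traces A \<theta> B" "w2 \<in> subalphabet_traces A \<theta> B"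
    "w1' \<in> subalphabet_traces A \<theta> B" "w2' \<in> subalphabet_traces A \<theta> B"
    "IA A \<theta> (tr [z] \<cdot> w1) = {z}" "IA A \<theta> (tr [z] \<cdot> w1') = {z}"
    "IA A \<theta> (tr [z'] \<cdot> w2) = {z'}" "IA A \<theta> (tr [z'] \<cdot> w2') = {z'}"
    "tr [z] \<cdot> w1 \<cdot> tr [z'] \<cdot> w2 = tr [z'] \<cdot> w2' \<cdot> tr [z] \<cdot> w1'"
    "w2 \<noteq> w2'"
proof -
  obtain bs where bs: "bs \<noteq> []" "set bs \<subseteq> B"
    and path: "successively (\<lambda>x y. (x, y) \<in> dep) (z # bs @ [z'])"
    using assms(4) unfolding bridged_def by blast
  have "(last bs, z') \<in> dep" using path bs by (auto simp: successively_append_iff successively_Cons)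
  then have "\<exists>b \<in> set bs. (b, z') \<in> dep" using bs by auto
  then obtain ps b qs where split: "bs = ps @ b # qs" and b: "(b, z') \<in> dep"
    and first: "\<forall>c \<in> set ps. (c, z') \<notin> dep"
    using split_list_first_prop[of bs "\<lambda>b. (b, z') \<in> dep"] by blast
  have L: "ps \<in> lists B" "[b] \<in> lists B" "ps @ [b] \<in> lists B" "[] \<in> lists B"
    using bs split by auto
  note LA = L[THEN lists_B]
  have path_b: "successively (\<lambda>x y. (x, y) \<in> dep) (z # ps @ [b])"
    using path split successively_append_iff[of _ "z # ps @ [b]" "qs @ [z']"] by simp
  then have path_ps: "successively (\<lambda>x y. (x, y) \<in> dep) (z # ps)"
    using successively_append_iff[of _ "z # ps" "[b]"] by simp
  have "set (z # ps) \<times> set [z'] \<subseteq> \<theta>"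
    using first z L(1) B by (auto simp: dep_iff)
  then have swap: "(z # ps) @ [z'] \<sim> [z'] @ z # ps"
    using z LA by (intro trace_mult_commute) auto
  have "((z # ps) @ [z']) @ [b] \<sim> ([z'] @ z # ps) @ [b]"
    using trace_cong_append_right[OF swap LA(2)] .
  then have eq: "tr (z # ps @ z' # [b]) = tr (z' # z # ps @ [b])"
    by (intro trace_of_eqI) simp
  have zA: "z \<in> A" "z' \<in> A" using z by auto
  show ?thesis
  proof (rule that[of "tr ps" "tr [b]" "tr (ps @ [b])" "tr []"])
    show "IA A \<theta> (tr [z] \<cdot> tr ps) = {z}" "IA A \<theta> (tr [z] \<cdot> tr (ps @ [b])) = {z}"
      "IA A \<theta> (tr [z'] \<cdot> tr [b]) = {z'}" "IA A \<theta> (tr [z'] \<cdot> tr []) = {z'}"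
      unfolding letter_mult_tr[OF zA(1) L(1)] letter_mult_tr[OF zA(1) L(3)]
        letter_mult_tr[OF zA(2) L(2)] letter_mult_tr[OF zA(2) L(4)]
      using zA LA path_b path_ps dep_sym[OF b] by (simp_all add: IA_path_trace)
    show "tr [z] \<cdot> tr ps \<cdot> tr [z'] \<cdot> tr [b] = tr [z'] \<cdot> tr [] \<cdot> tr [z] \<cdot> tr (ps @ [b])"
      using zA LA eq by (simp add: trace_of_mult)
    show "tr [b] \<noteq> tr []"
      using Alph_trace_of[OF LA(2), of \<theta>] Alph_trace_of[OF LA(4), of \<theta>] by auto
  qed (use L in \<open>auto simp: subalphabet_traces_eq simp del: in_lists_conv_set\<close>)
qed

end

theorem theorem5:
  fixes A B Z :: "'a set" and \<theta> :: "('a \<times> 'a) set"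
  assumes "independence_alphabet A \<theta>"
    and "B \<subseteq> A"
    and "Z = A - B"
  shows "(TFSA A \<theta> B \<longleftrightarrow>
      (\<forall>z\<^sub>1 \<in> Z. \<forall>z\<^sub>2 \<in> Z. z\<^sub>1 \<noteq> z\<^sub>2 \<longrightarrow>
        (\<forall>w\<^sub>1 \<in> subalphabet_traces A \<theta> B. \<forall>w\<^sub>2 \<in> subalphabet_traces A \<theta> B.
         \<forall>w\<^sub>1' \<in> subalphabet_traces A \<theta> B. \<forall>w\<^sub>2' \<in> subalphabet_traces A \<theta> B.
          IA A \<theta> (letter A \<theta> z\<^sub>1 \<otimes>\<^bsub>trace_monoid A \<theta>\<^esub> w\<^sub>1) = {z\<^sub>1} \<and>
          IA A \<theta> (letter A \<theta> z\<^sub>1 \<otimes>\<^bsub>trace_monoid A \<theta>\<^esub> w\<^sub>1') = {z\<^sub>1} \<and>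
          IA A \<theta> (letter A \<theta> z\<^sub>2 \<otimes>\<^bsub>trace_monoid A \<theta>\<^esub> w\<^sub>2) = {z\<^sub>2} \<and>
          IA A \<theta> (letter A \<theta> z\<^sub>2 \<otimes>\<^bsub>trace_monoid A \<theta>\<^esub> w\<^sub>2') = {z\<^sub>2} \<longrightarrow>
          letter A \<theta> z\<^sub>1 \<otimes>\<^bsub>trace_monoid A \<theta>\<^esub> w\<^sub>1 \<otimes>\<^bsub>trace_monoid A \<theta>\<^esub> letter A \<theta> z\<^sub>2 \<otimes>\<^bsub>trace_monoid A \<theta>\<^esub> w\<^sub>2 =
          letter A \<theta> z\<^sub>2 \<otimes>\<^bsub>trace_monoid A \<theta>\<^esub> w\<^sub>2' \<otimes>\<^bsub>trace_monoid A \<theta>\<^esub> letter A \<theta> z\<^sub>1 \<otimes>\<^bsub>trace_monoid A \<theta>\<^esub> w\<^sub>1' \<longrightarrow>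
          w\<^sub>1 = w\<^sub>1' \<and> w\<^sub>2 = w\<^sub>2'))) \<and>
    (TFSA A \<theta> B \<longleftrightarrow>
      (\<forall>(z, z') \<in> (Z \<times> Z) \<inter> \<theta>.
        \<not> (\<exists>bs. bs \<noteq> [] \<and> set bs \<subseteq> B \<and>
              successively (\<lambda>x y. (x, y) \<in> dependence_edges A \<theta>) (z # bs @ [z']))))"
proof -
  interpret subalphabet A \<theta> B
    using assms(1,2) by unfold_locales
  let ?ii = "\<forall>z\<^sub>1 \<in> Z. \<forall>z\<^sub>2 \<in> Z. z\<^sub>1 \<noteq> z\<^sub>2 \<longrightarrow>
        (\<forall>w\<^sub>1 \<in> subalphabet_traces A \<theta> B. \<forall>w\<^sub>2 \<in> subalphabet_traces A \<theta> B.
         \<forall>w\<^sub>1' \<in> subalphabet_traces A \<theta> B. \<forall>w\<^sub>2' \<in> subalphabet_traces A \<theta> B.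
          IA A \<theta> (tr [z\<^sub>1] \<cdot> w\<^sub>1) = {z\<^sub>1} \<and> IA A \<theta> (tr [z\<^sub>1] \<cdot> w\<^sub>1') = {z\<^sub>1} \<and>
          IA A \<theta> (tr [z\<^sub>2] \<cdot> w\<^sub>2) = {z\<^sub>2} \<and> IA A \<theta> (tr [z\<^sub>2] \<cdot> w\<^sub>2') = {z\<^sub>2} \<longrightarrow>
          tr [z\<^sub>1] \<cdot> w\<^sub>1 \<cdot> tr [z\<^sub>2] \<cdot> w\<^sub>2 = tr [z\<^sub>2] \<cdot> w\<^sub>2' \<cdot> tr [z\<^sub>1] \<cdot> w\<^sub>1' \<longrightarrow>
          w\<^sub>1 = w\<^sub>1' \<and> w\<^sub>2 = w\<^sub>2')"
  let ?iii = "\<forall>(z, z') \<in> (Z \<times> Z) \<inter> \<theta>. \<not> bridged z z'"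
  have i_ii: "TFSA A \<theta> B \<Longrightarrow> ?ii"
    unfolding assms(3) using TFSA_exchange_unique by blast
  have ii_iii: "?iii" if ii: ?ii
  proof -
    have "\<not> bridged z z'" if z: "z \<in> A - B" "z' \<in> A - B" "(z, z') \<in> \<theta>" for z z'
    proof
      assume "bridged z z'"
      from z this obtain w1 w2 w1' w2' where
        "w1 \<in> subalphabet_traces A \<theta> B" "w2 \<in> subalphabet_traces A \<theta> B"
        "w1' \<in> subalphabet_traces A \<theta> B" "w2' \<in> subalphabet_traces A \<theta> B"
        "IA A \<theta> (tr [z] \<cdot> w1) = {z}" "IA A \<theta> (tr [z] \<cdot> w1') = {z}"
        "IA A \<theta> (tr [z'] \<cdot> w2) = {z'}" "IA A \<theta> (tr [z'] \<cdot> w2') = {z'}"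
        "tr [z] \<cdot> w1 \<cdot> tr [z'] \<cdot> w2 = tr [z'] \<cdot> w2' \<cdot> tr [z] \<cdot> w1'" "w2 \<noteq> w2'"
        by (rule exchange_witness)
      moreover have "z \<noteq> z'" using z irrefl_indep by blast
      ultimately show False using ii z unfolding assms(3) by blast
    qed
    then show ?thesis unfolding assms(3) by blast
  qed
  have iii_i: "?iii \<Longrightarrow> TFSA A \<theta> B"
    unfolding assms(3) by (rule TFSA_if_no_bridge) blast
  have "TFSA A \<theta> B \<longleftrightarrow> ?ii" "TFSA A \<theta> B \<longleftrightarrow> ?iii"
    using i_ii ii_iii iii_i by argo+
  then show ?thesis unfolding bridged_def by (rule conjI)
qed

end
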